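(* For any positive integer $d$, $\frac{2^d}{d+1}\le\gamma_f^\infty(Q_d)\le\frac{2^d+d}{d+1}$.
   Context: $Q_d$ is the hypercube of dimension $d$ (vertices are binary strings of length $d$, adjacent if they differ in exactly one position). $N(v)$ is the open neighbourhood and $N[v]=N(v)\cup\{v\}$ the closed neighbourhood of $v$. A fractional dominating function of a finite simple graph $G=(V,E)$ is a function $w:V\to[0,\infty)$ with $\sum_{x\in N[v]}w(x)\ge 1$ for all $v\in V$; its total weight is $\sum_{x\in V}w(x)$. Fractional eternal domination. Fix $S$. The defender chooses a fractional dominating function $w_1$ of total weight at most $S$. In each round $i\ge 1$ the attacker, who may choose attacks adaptively, attacks a vertex $v_i\in V$, and the defender chooses amounts $m_{xy,i}\ge 0$ for all $x\in V$, $y\in N(x)$, with $\sum_{y\in N(x)}m_{xy,i}\le w_i(x)$, and sets $w_{i+1}(x)=w_i(x)-\sum_{y\in N(x)}m_{xy,i}+\sum_{y\in N(x)}m_{yx,i}$. It is required that $w_{i+1}$ be a fractional dominating function and $w_{i+1}(v_i)\ge 1$. If the defender can respond in this way to every infinite sequence of attacks, $G$ can be eternally $S$-fractionally dominated. $\gamma_f^\infty(G)$ is the infimum of all $S$ for which $G$ can be eternally $S$-fractionally dominated. *)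

theory Defs
  imports Complex_Main
begin

text \<open>A graph is given by its vertex set and an adjacency relation on it.\<close>

definition finite_simple_graph :: "'a set \<Rightarrow> ('a \<Rightarrow> 'a \<Rightarrow> bool) \<Rightarrow> bool" where
  "finite_simple_graph V adj \<longleftrightarrow>
     finite V \<and> (\<forall>x\<in>V. \<not> adj x x) \<and> (\<forall>x\<in>V. \<forall>y\<in>V. adj x y \<longrightarrow> adj y x)"

definition open_nbhd :: "'a set \<Rightarrow> ('a \<Rightarrow> 'a \<Rightarrow> bool) \<Rightarrow> 'a \<Rightarrow> 'a set" where
  "open_nbhd V adj v = {u \<in> V. adj v u}"

definition closed_nbhd :: "'a set \<Rightarrow> ('a \<Rightarrow> 'a \<Rightarrow> bool) \<Rightarrow> 'a \<Rightarrow> 'a set" where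
  "closed_nbhd V adj v = insert v (open_nbhd V adj v)"

definition fractional_dominating ::
    "'a set \<Rightarrow> ('a \<Rightarrow> 'a \<Rightarrow> bool) \<Rightarrow> ('a \<Rightarrow> real) \<Rightarrow> bool" where
  "fractional_dominating V adj w \<longleftrightarrow>
     (\<forall>x\<in>V. w x \<ge> 0) \<and> (\<forall>v\<in>V. (\<Sum>x\<in>closed_nbhd V adj v. w x) \<ge> 1)"

text \<open>In a move \<open>m\<close>, the amount \<open>m x y\<close> is sent from \<open>x\<close> to its neighbour \<open>y\<close>;
  values of \<open>m\<close> on other pairs are irrelevant.\<close>

definition legal_move ::
    "'a set \<Rightarrow> ('a \<Rightarrow> 'a \<Rightarrow> bool) \<Rightarrow> ('a \<Rightarrow> real) \<Rightarrow> ('a \<Rightarrow> 'a \<Rightarrow> real) \<Rightarrow> bool" where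
  "legal_move V adj w m \<longleftrightarrow>
     (\<forall>x\<in>V. (\<forall>y\<in>open_nbhd V adj x. m x y \<ge> 0) \<and> (\<Sum>y\<in>open_nbhd V adj x. m x y) \<le> w x)"

definition apply_move ::
    "'a set \<Rightarrow> ('a \<Rightarrow> 'a \<Rightarrow> bool) \<Rightarrow> ('a \<Rightarrow> real) \<Rightarrow> ('a \<Rightarrow> 'a \<Rightarrow> real) \<Rightarrow> 'a \<Rightarrow> real" where
  "apply_move V adj w m x =
     w x - (\<Sum>y\<in>open_nbhd V adj x. m x y) + (\<Sum>y\<in>open_nbhd V adj x. m y x)"

text \<open>A defender strategy \<open>\<sigma>\<close> maps the list of attacks made so far, including the current one,
  to the move made in response; the defender does not see future attacks. Since the defender's
  replies are thereby a function of the attacks, an adaptive attacker amounts to an arbitrary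
  attack sequence. Rounds are counted from 0, so \<open>weighting V adj w \<sigma> v i\<close> is the weighting
  held before attack \<open>v i\<close>.\<close>

definition response :: "('a list \<Rightarrow> 'a \<Rightarrow> 'a \<Rightarrow> real) \<Rightarrow> (nat \<Rightarrow> 'a) \<Rightarrow> nat \<Rightarrow> 'a \<Rightarrow> 'a \<Rightarrow> real" where
  "response \<sigma> v i = \<sigma> (map v [0..<Suc i])"

primrec weighting ::
    "'a set \<Rightarrow> ('a \<Rightarrow> 'a \<Rightarrow> bool) \<Rightarrow> ('a \<Rightarrow> real) \<Rightarrow> ('a list \<Rightarrow> 'a \<Rightarrow> 'a \<Rightarrow> real) \<Rightarrow>
     (nat \<Rightarrow> 'a) \<Rightarrow> nat \<Rightarrow> 'a \<Rightarrow> real" where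
  "weighting V adj w \<sigma> v 0 = w"
| "weighting V adj w \<sigma> v (Suc i) =
     apply_move V adj (weighting V adj w \<sigma> v i) (response \<sigma> v i)"

definition eternally_fractionally_dominated ::
    "'a set \<Rightarrow> ('a \<Rightarrow> 'a \<Rightarrow> bool) \<Rightarrow> real \<Rightarrow> bool" where
  "eternally_fractionally_dominated V adj S \<longleftrightarrow>
     (\<exists>w \<sigma>. fractional_dominating V adj w \<and> (\<Sum>x\<in>V. w x) \<le> S \<and>
        (\<forall>v. (\<forall>i. v i \<in> V) \<longrightarrow>
          (\<forall>i. legal_move V adj (weighting V adj w \<sigma> v i) (response \<sigma> v i) \<and>
               fractional_dominating V adj (weighting V adj w \<sigma> v (Suc i)) \<and>
               weighting V adj w \<sigma> v (Suc i) (v i) \<ge> 1)))"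

definition fractional_eternal_domination_number ::
    "'a set \<Rightarrow> ('a \<Rightarrow> 'a \<Rightarrow> bool) \<Rightarrow> real" where
  "fractional_eternal_domination_number V adj =
     Inf {S. eternally_fractionally_dominated V adj S}"

text \<open>For finite simple graphs the infimum is that of a nonempty set bounded below, so the
  unspecified values of \<^term>\<open>Inf\<close> on the reals do not arise.\<close>

lemma eternally_fractionally_dominated_card:
  assumes "finite_simple_graph V adj"
  shows "eternally_fractionally_dominated V adj (real (card V))"
proof -
  let ?w = "\<lambda>x. 1 :: real" and ?s = "\<lambda>h x y. 0 :: real"
  have w: "weighting V adj ?w ?s v i = ?w" for v i
    by (induction i) (auto simp: apply_move_def response_def)
  have "card (closed_nbhd V adj v) \<ge> 1" for v
    using assms by (simp add: finite_simple_graph_def closed_nbhd_def open_nbhd_def card_insert_if)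
  then have d: "fractional_dominating V adj ?w"
    by (simp add: fractional_dominating_def)
  show ?thesis
    unfolding eternally_fractionally_dominated_def
    by (rule exI[of _ ?w], rule exI[of _ ?s])
      (simp only: w d, simp add: legal_move_def response_def)
qed

lemma bdd_below_eternally_fractionally_dominated:
  "bdd_below {S. eternally_fractionally_dominated V adj S}"
  by (rule bdd_belowI[of _ 0])
    (auto simp: eternally_fractionally_dominated_def fractional_dominating_def
      intro: order_trans[OF sum_nonneg])

definition hypercube_verts :: "nat \<Rightarrow> bool list set" where
  "hypercube_verts d = {x. length x = d}"

definition hypercube_adj :: "nat \<Rightarrow> bool list \<Rightarrow> bool list \<Rightarrow> bool" where
  "hypercube_adj d x y \<longleftrightarrow> card {i. i < d \<and> x ! i \<noteq> y ! i} = 1"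

lemma finite_simple_graph_hypercube:
  "finite_simple_graph (hypercube_verts d) (hypercube_adj d)"
  using finite_lists_length_eq[of "UNIV :: bool set" d]
  by (auto simp: finite_simple_graph_def hypercube_verts_def hypercube_adj_def eq_commute)

end

theory Submission
  imports Defs
begin

text \<open>
  Lower bound: every vertex of \<open>Q\<^sub>d\<close> lies in exactly \<open>d + 1\<close> closed neighbourhoods, so adding up the
  \<open>2\<^sup>d\<close> domination constraints of a fractional dominating function gives \<open>d + 1\<close> times its weight.

  Upper bound: the defender always holds weight \<open>1\<close> on the vertex attacked last and \<open>1/(d+1)\<close> on
  every other vertex. The uniform part already dominates, and the total is
  \<open>1 + (2\<^sup>d - 1)/(d+1) = (2\<^sup>d + d)/(d+1)\<close>. What has to be shown is that the surplus \<open>d/(d+1)\<close> can be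
  carried from any \<open>u\<close> to any \<open>v \<noteq> u\<close> in one round. Since all transfers of a round are
  simultaneous, weight cannot travel along a path; but if each vertex passes on some of its own
  weight and receives as much, then the same final weighting results. In units of \<open>1/(d+1)\<close> this
  requires a flow of value \<open>d\<close> from \<open>u\<close> to \<open>v\<close> in which at most \<open>1\<close> passes through each vertex other
  than \<open>u\<close> and \<open>v\<close>.

  Such a flow could be had from \<open>d\<close> internally disjoint paths, but a fractional flow is more
  symmetric. Let \<open>D\<close> be the set of the \<open>k\<close> coordinates in which \<open>u\<close> and \<open>v\<close> differ, and describe a
  vertex by the set \<open>X\<close> of coordinates in which it differs from \<open>u\<close>; thus \<open>u\<close> is \<open>{}\<close> and \<open>v\<close> is \<open>D\<close>.
  A flow of value \<open>k\<close> rises through the levels of the subcube \<open>{X. X \<subseteq> D}\<close>, spread evenly over each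
  level: a set of size \<open>a\<close> carries \<open>k / (k choose a)\<close>, which is at most \<open>1\<close> if \<open>0 < a < k\<close>. For each
  coordinate \<open>j\<close> outside \<open>D\<close>, one more unit goes from \<open>{}\<close> to \<open>{j}\<close>, rises evenly through the parallel
  subcube \<open>{insert j A |A. A \<subseteq> D}\<close> and drops from \<open>insert j D\<close> to \<open>D\<close>. The subcubes are disjoint, so the
  bound on the passing flow holds for the sum, and the values add up to \<open>k + (d - k) = d\<close>.
\<close>

section \<open>Eternal domination by a family of weightings\<close>

lemma sum_closed_nbhds:
  fixes w :: "'a \<Rightarrow> real"
  assumes G: "finite_simple_graph V adj"
    and reg: "\<And>x. x \<in> V \<Longrightarrow> card (closed_nbhd V adj x) = r"
  shows "(\<Sum>v\<in>V. \<Sum>x\<in>closed_nbhd V adj v. w x) = real r * (\<Sum>x\<in>V. w x)"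
proof -
  have fin: "finite V" and sym: "\<And>x y. x \<in> V \<Longrightarrow> y \<in> V \<Longrightarrow> adj x y \<Longrightarrow> adj y x"
    using G by (auto simp: finite_simple_graph_def)
  have N: "closed_nbhd V adj v = {x \<in> V. x = v \<or> adj v x}" if "v \<in> V" for v
    using that by (auto simp: closed_nbhd_def open_nbhd_def)
  have N': "closed_nbhd V adj x = {v \<in> V. x = v \<or> adj v x}" if "x \<in> V" for x
    using that sym by (auto simp: closed_nbhd_def open_nbhd_def)
  have "(\<Sum>v\<in>V. \<Sum>x\<in>closed_nbhd V adj v. w x) = (\<Sum>v\<in>V. \<Sum>x | x \<in> V \<and> (x = v \<or> adj v x). w x)"
    by (intro sum.cong) (auto simp: N)
  also have "\<dots> = (\<Sum>x\<in>V. \<Sum>v | v \<in> V \<and> (x = v \<or> adj v x). w x)"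
    by (rule sum.swap_restrict[OF fin fin])
  also have "\<dots> = (\<Sum>x\<in>V. \<Sum>v\<in>closed_nbhd V adj x. w x)"
    by (intro sum.cong) (auto simp: N')
  also have "\<dots> = real r * (\<Sum>x\<in>V. w x)"
    by (simp add: reg sum_distrib_left)
  finally show ?thesis .
qed

lemma card_le_eternally_fractionally_dominated:
  assumes G: "finite_simple_graph V adj"
    and reg: "\<And>x. x \<in> V \<Longrightarrow> card (closed_nbhd V adj x) = r"
    and S: "eternally_fractionally_dominated V adj S"
  shows "real (card V) \<le> real r * S"
proof -
  obtain w where w: "fractional_dominating V adj w" and wS: "(\<Sum>x\<in>V. w x) \<le> S"
    using S by (auto simp: eternally_fractionally_dominated_def)
  have "real (card V) = (\<Sum>v\<in>V. 1)" by simp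
  also have "\<dots> \<le> (\<Sum>v\<in>V. \<Sum>x\<in>closed_nbhd V adj v. w x)"
    using w by (intro sum_mono) (auto simp: fractional_dominating_def)
  also have "\<dots> = real r * (\<Sum>x\<in>V. w x)"
    by (rule sum_closed_nbhds[OF G reg])
  also have "\<dots> \<le> real r * S"
    using wS by (intro mult_left_mono) auto
  finally show ?thesis .
qed

text \<open>The weighting held depends only on the last attack, so a reply depends only on the last two
  attacks.\<close>

lemma eternally_fractionally_dominated_family:
  assumes v0: "v0 \<in> V"
    and dom: "\<And>v. v \<in> V \<Longrightarrow> fractional_dominating V adj (W v)"
    and tot: "(\<Sum>x\<in>V. W v0 x) \<le> S"
    and one: "\<And>v. v \<in> V \<Longrightarrow> W v v \<ge> 1"
    and legal: "\<And>u v. u \<in> V \<Longrightarrow> v \<in> V \<Longrightarrow> legal_move V adj (W u) (m u v)"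
    and moved: "\<And>u v x. u \<in> V \<Longrightarrow> v \<in> V \<Longrightarrow> x \<in> V \<Longrightarrow> apply_move V adj (W u) (m u v) x = W v x"
  shows "eternally_fractionally_dominated V adj S"
proof -
  define \<sigma> where "\<sigma> h = m (if butlast h = [] then v0 else last (butlast h)) (last h)" for h
  define p where "p v i = (case i of 0 \<Rightarrow> v0 | Suc j \<Rightarrow> v j)" for v :: "nat \<Rightarrow> 'a" and i
  have resp: "response \<sigma> v i = m (p v i) (v i)" for v i
    by (cases i) (simp_all add: response_def \<sigma>_def p_def butlast_append)
  have domcong: "fractional_dominating V adj w"
    if "fractional_dominating V adj w'" "\<And>x. x \<in> V \<Longrightarrow> w x = w' x" for w w'
  proof -
    have "(\<Sum>x\<in>closed_nbhd V adj v. w x) = (\<Sum>x\<in>closed_nbhd V adj v. w' x)" if "v \<in> V" for v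
      using \<open>\<And>x. x \<in> V \<Longrightarrow> w x = w' x\<close> that
      by (intro sum.cong) (auto simp: closed_nbhd_def open_nbhd_def)
    then show ?thesis using that by (simp add: fractional_dominating_def)
  qed
  have main: "legal_move V adj (weighting V adj (W v0) \<sigma> v i) (response \<sigma> v i) \<and>
      fractional_dominating V adj (weighting V adj (W v0) \<sigma> v (Suc i)) \<and>
      weighting V adj (W v0) \<sigma> v (Suc i) (v i) \<ge> 1" if vV: "\<forall>i. v i \<in> V" for v i
  proof -
    have pV: "p v i \<in> V" for i using vV v0 by (simp add: p_def split: nat.split)
    have wt: "weighting V adj (W v0) \<sigma> v i x = W (p v i) x" if "x \<in> V" for i x
      using that
    proof (induction i)
      case 0
      then show ?case by (simp add: p_def)
    next
      case (Suc i)
      have "weighting V adj (W v0) \<sigma> v (Suc i) x = apply_move V adj (W (p v i)) (m (p v i) (v i)) x"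
        using Suc by (simp add: apply_move_def resp)
      also have "\<dots> = W (p v (Suc i)) x"
        using moved[OF pV _ Suc.prems] vV by (simp add: p_def)
      finally show ?case .
    qed
    have "legal_move V adj (weighting V adj (W v0) \<sigma> v i) (response \<sigma> v i)"
      using legal[OF pV[of i]] vV wt[of _ i] by (simp add: legal_move_def resp)
    moreover have "fractional_dominating V adj (weighting V adj (W v0) \<sigma> v (Suc i))"
      using domcong[OF dom[OF pV[of "Suc i"]]] wt[of _ "Suc i"] by blast
    moreover have "weighting V adj (W v0) \<sigma> v (Suc i) (v i) \<ge> 1"
      using wt[of "v i" "Suc i"] one vV by (simp add: p_def)
    ultimately show ?thesis by blast
  qed
  show ?thesis
    unfolding eternally_fractionally_dominated_def
    using dom[OF v0] tot main by blast
qed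

section \<open>The flow\<close>

definition toggle :: "nat \<Rightarrow> nat set \<Rightarrow> nat set" where
  "toggle i X = (if i \<in> X then X - {i} else insert i X)"

text \<open>The flow that a unit, spread evenly over the levels of a \<open>k\<close>-dimensional cube, sends through
  each edge from level \<open>a\<close> to level \<open>a + 1\<close>: the number of these edges is
  \<open>(k - a) * (k choose a) = k * (k - 1 choose a)\<close>.\<close>

definition edge_flow :: "nat \<Rightarrow> nat \<Rightarrow> real" where
  "edge_flow k a = 1 / (real k * real ((k - 1) choose a))"

text \<open>The value of the part of the flow that stays in the subcube \<open>{A \<union> B |A. A \<subseteq> D}\<close>.\<close>

definition subcube_value :: "nat set \<Rightarrow> nat set \<Rightarrow> real" where
  "subcube_value D B = (if B = {} then real (card D) else if card B = 1 then 1 else 0)"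

text \<open>The amount that \<open>X\<close> sends to \<open>toggle i X\<close>, in the flow from \<open>{}\<close> to \<open>D\<close>.\<close>

definition cube_flow :: "nat set \<Rightarrow> nat set \<Rightarrow> nat \<Rightarrow> real" where
  "cube_flow D X i =
     (if i \<in> D
      then if i \<in> X then 0 else subcube_value D (X - D) * edge_flow (card D) (card (X \<inter> D))
      else if X = {} \<or> X = insert i D then 1 else 0)"

lemma edge_flow_nonneg: "edge_flow k a \<ge> 0"
  by (simp add: edge_flow_def)

lemma subcube_value_nonneg: "subcube_value D B \<ge> 0"
  by (simp add: subcube_value_def)

lemma cube_flow_nonneg: "cube_flow D X i \<ge> 0"
  by (simp add: cube_flow_def edge_flow_nonneg subcube_value_nonneg)

text \<open>Conservation of the flow between the levels: what leaves a set of size \<open>a\<close> through its \<open>k - a\<close>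
  upward edges equals what it receives through its \<open>a\<close> downward edges, namely its even share
  of the unit.\<close>

lemma edge_flow_up:
  assumes "a < k"
  shows "real (k - a) * edge_flow k a = 1 / real (k choose a)"
proof -
  have "real k * real ((k - 1) choose a) = real (k - a) * real (k choose a)"
    using binomial_absorb_comp[of k a] by (metis of_nat_mult)
  then show ?thesis using assms by (simp add: edge_flow_def)
qed

lemma edge_flow_down:
  assumes "0 < a"
  shows "real a * edge_flow k (a - 1) = 1 / real (k choose a)"
proof -
  have "real k * real ((k - 1) choose (a - 1)) = real a * real (k choose a)"
    using times_binomial_minus1_eq[OF assms, of k] by (metis of_nat_mult)
  then show ?thesis using assms by (simp add: edge_flow_def)
qed

lemma le_choose:
  assumes "0 < a" "a < k"
  shows "k \<le> k choose a"
proof (cases "2 * a \<le> k")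
  case True
  then show ?thesis using binomial_mono[of 1 a k] assms by simp
next
  case False
  then show ?thesis using binomial_mono[of 1 "k - a" k] binomial_symmetric[of a k] assms by simp
qed

context
  fixes d :: nat and D X :: "nat set"
  assumes D: "D \<subseteq> {..<d}" "D \<noteq> {}" and X: "X \<subseteq> {..<d}"
begin

private lemma fin: "finite D" "finite X"
  using D X by (auto intro: finite_subset)

private lemma outside: "card ({..<d} - D) = d - card D"
  using D fin by (simp add: card_Diff_subset)

private lemma sum_split:
  fixes g :: "nat \<Rightarrow> real"
  shows "(\<Sum>i<d. g i) = (\<Sum>i\<in>D. g i) + (\<Sum>i\<in>{..<d} - D. g i)"
  using sum.subset_diff[OF D(1), of g] by simp

private lemma out_inside:
  "(\<Sum>i\<in>D. cube_flow D X i) =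
     (if D \<subseteq> X then 0 else subcube_value D (X - D) / real (card D choose card (X \<inter> D)))"
proof -
  have "(\<Sum>i\<in>D. cube_flow D X i)
      = (\<Sum>i\<in>D - X. subcube_value D (X - D) * edge_flow (card D) (card (X \<inter> D)))"
    using fin by (intro sum.mono_neutral_cong_right) (auto simp: cube_flow_def)
  also have "\<dots> = subcube_value D (X - D) *
      (real (card D - card (X \<inter> D)) * edge_flow (card D) (card (X \<inter> D)))"
    using card_Diff_subset_Int[of D X] fin by (simp add: Int_commute)
  finally have e: "(\<Sum>i\<in>D. cube_flow D X i) = \<dots>" .
  show ?thesis
  proof (cases "D \<subseteq> X")
    case True
    then have "X \<inter> D = D" by auto
    then show ?thesis using e True by simp
  next
    case False
    then have "card (X \<inter> D) < card D" using fin by (intro psubset_card_mono) auto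
    then show ?thesis using e False by (simp only: edge_flow_up) simp
  qed
qed

private lemma in_inside:
  "(\<Sum>i\<in>D. cube_flow D (toggle i X) i) =
     (if X \<inter> D = {} then 0 else subcube_value D (X - D) / real (card D choose card (X \<inter> D)))"
proof -
  have "(\<Sum>i\<in>D. cube_flow D (toggle i X) i)
      = (\<Sum>i\<in>X \<inter> D. subcube_value D (X - D) * edge_flow (card D) (card (X \<inter> D) - 1))"
  proof (intro sum.mono_neutral_cong_right)
    fix i assume i: "i \<in> X \<inter> D"
    then have "toggle i X - D = X - D" "toggle i X \<inter> D = X \<inter> D - {i}"
      by (auto simp: toggle_def)
    then show "cube_flow D (toggle i X) i =
        subcube_value D (X - D) * edge_flow (card D) (card (X \<inter> D) - 1)"
      using i fin by (auto simp: cube_flow_def)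
  qed (use fin in \<open>auto simp: cube_flow_def toggle_def\<close>)
  also have "\<dots> = subcube_value D (X - D) *
      (real (card (X \<inter> D)) * edge_flow (card D) (card (X \<inter> D) - 1))"
    by simp
  finally have e: "(\<Sum>i\<in>D. cube_flow D (toggle i X) i) = \<dots>" .
  show ?thesis
  proof (cases "X \<inter> D = {}")
    case False
    then have "0 < card (X \<inter> D)" using fin by (simp add: card_gt_0_iff)
    then show ?thesis using e False by (simp only: edge_flow_down) simp
  qed (simp add: e)
qed

private lemma sum_singleton_outside:
  "(\<Sum>i\<in>{..<d} - D. if X - D = {i} then 1 else 0 :: real) = (if card (X - D) = 1 then 1 else 0)"
proof (cases "card (X - D) = 1")
  case True
  then obtain j where j: "X - D = {j}" by (auto simp: card_1_singleton_iff)
  then have "j \<in> {..<d} - D" using X by auto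
  then show ?thesis using j by simp
next
  case False
  then have "X - D \<noteq> {i}" for i by auto
  then show ?thesis using False by simp
qed

private lemma out_outside:
  "(\<Sum>i\<in>{..<d} - D. cube_flow D X i) =
     (if X = {} then real (d - card D) else 0) + (if card (X - D) = 1 \<and> D \<subseteq> X then 1 else 0)"
proof -
  have "(\<Sum>i\<in>{..<d} - D. cube_flow D X i) = (\<Sum>i\<in>{..<d} - D.
      (if X = {} then 1 else 0) + (if D \<subseteq> X then if X - D = {i} then 1 else 0 else 0))"
    using D by (intro sum.cong refl) (auto simp: cube_flow_def)
  also have "\<dots> = (if X = {} then real (d - card D) else 0) +
      (if D \<subseteq> X then \<Sum>i\<in>{..<d} - D. if X - D = {i} then 1 else 0 else 0)"
    by (simp add: sum.distrib outside)
  also have "\<dots> = (if X = {} then real (d - card D) else 0) +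
      (if card (X - D) = 1 \<and> D \<subseteq> X then 1 else 0)"
    by (simp only: sum_singleton_outside) simp
  finally show ?thesis .
qed

private lemma in_outside:
  "(\<Sum>i\<in>{..<d} - D. cube_flow D (toggle i X) i) =
     (if X = D then real (d - card D) else 0) + (if card (X - D) = 1 \<and> X \<inter> D = {} then 1 else 0)"
proof -
  have "(\<Sum>i\<in>{..<d} - D. cube_flow D (toggle i X) i) = (\<Sum>i\<in>{..<d} - D.
      (if X = D then 1 else 0) + (if X \<inter> D = {} then if X - D = {i} then 1 else 0 else 0))"
  proof (intro sum.cong refl)
    fix i assume i: "i \<in> {..<d} - D"
    have "toggle i X = {} \<longleftrightarrow> X \<inter> D = {} \<and> X - D = {i}"
      using i by (auto simp: toggle_def)
    moreover have "toggle i X = insert i D \<longleftrightarrow> X = D"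
      using i by (auto simp: toggle_def)
    ultimately show "cube_flow D (toggle i X) i =
        (if X = D then 1 else 0) + (if X \<inter> D = {} then if X - D = {i} then 1 else 0 else 0)"
      using i D by (auto simp: cube_flow_def)
  qed
  also have "\<dots> = (if X = D then real (d - card D) else 0) +
      (if X \<inter> D = {} then \<Sum>i\<in>{..<d} - D. if X - D = {i} then 1 else 0 else 0)"
    by (simp add: sum.distrib outside)
  also have "\<dots> = (if X = D then real (d - card D) else 0) +
      (if card (X - D) = 1 \<and> X \<inter> D = {} then 1 else 0)"
    by (simp only: sum_singleton_outside) simp
  finally show ?thesis .
qed

text \<open>Inside a subcube, inflow and outflow differ only at its bottom and its top. The edges in
  directions outside \<open>D\<close> cancel this difference, except at \<open>{}\<close> and \<open>D\<close>.\<close>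

lemma cube_flow_balance:
  "(\<Sum>i<d. cube_flow D X i) - (\<Sum>i<d. cube_flow D (toggle i X) i) =
     (if X = {} then real d else 0) - (if X = D then real d else 0)"
proof -
  have kd: "card D \<le> d" using card_mono[OF _ D(1)] by simp
  have top: "card D choose card (X \<inter> D) = 1" if "D \<subseteq> X"
    using that by (simp add: Int_absorb1)
  have XD: "X = D \<longleftrightarrow> D \<subseteq> X \<and> X - D = {}" and X0: "X = {} \<longleftrightarrow> X \<inter> D = {} \<and> X - D = {}"
    by auto
  have both: "\<not> (D \<subseteq> X \<and> X \<inter> D = {})" using D by auto
  have B: "card (X - D) = Suc 0 \<Longrightarrow> \<not> X \<subseteq> D"
    by (metis Diff_eq_empty_iff card.empty nat.distinct(1))
  show ?thesis
    unfolding sum_split out_inside in_inside out_outside in_outside XD X0 subcube_value_def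
    using kd top both
    by (cases "D \<subseteq> X"; cases "X \<inter> D = {}"; cases "X - D = {}")
      (auto simp: of_nat_diff dest: B)
qed

lemma cube_flow_out_source:
  assumes "X = {}"
  shows "(\<Sum>i<d. cube_flow D X i) = real d"
proof -
  have "card D \<le> d" using card_mono[OF _ D(1)] by simp
  then show ?thesis
    unfolding sum_split out_inside out_outside subcube_value_def using D assms by simp
qed

lemma cube_flow_out_le_1:
  assumes "X \<noteq> {}"
  shows "(\<Sum>i<d. cube_flow D X i) \<le> 1"
proof (cases "D \<subseteq> X")
  case True
  then show ?thesis using assms by (simp add: sum_split out_inside out_outside)
next
  case False
  then have lt: "card (X \<inter> D) < card D" using fin by (intro psubset_card_mono) auto
  have "subcube_value D (X - D) \<le> real (card D choose card (X \<inter> D))"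
  proof (cases "X - D = {}")
    case True
    then have "0 < card (X \<inter> D)" using assms fin by (auto simp: card_gt_0_iff)
    then show ?thesis using True le_choose[OF _ lt] by (simp add: subcube_value_def)
  next
    case False
    have "1 \<le> card D choose card (X \<inter> D)" using lt by (simp add: Suc_leI)
    then show ?thesis using False by (simp add: subcube_value_def)
  qed
  then show ?thesis
    using assms False lt by (simp add: sum_split out_inside out_outside divide_le_eq)
qed

end

section \<open>The hypercube\<close>

definition flip :: "bool list \<Rightarrow> nat \<Rightarrow> bool list" where
  "flip x i = x[i := \<not> x ! i]"

definition diff :: "bool list \<Rightarrow> bool list \<Rightarrow> nat set" where
  "diff u x = {i. i < length u \<and> u ! i \<noteq> x ! i}"

lemma diff_subset: "diff u x \<subseteq> {..<length u}"
  by (auto simp: diff_def)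

lemma diff_flip:
  assumes "length u = d" "length x = d" "i < d"
  shows "diff u (flip x i) = toggle i (diff u x)"
  using assms by (auto simp: diff_def flip_def toggle_def nth_list_update)

lemma diff_eq_iff:
  assumes "length u = d" "length x = d" "length v = d"
  shows "diff u x = diff u v \<longleftrightarrow> x = v"
proof
  assume "diff u x = diff u v"
  then show "x = v" using assms by (intro nth_equalityI) (auto simp: diff_def set_eq_iff)
qed simp

lemma diff_self: "diff u u = {}"
  by (simp add: diff_def)

lemma diff_flip_self: "i < length x \<Longrightarrow> diff x (flip x i) = {i}" "i < length x \<Longrightarrow> diff (flip x i) x = {i}"
  by (auto simp: diff_def flip_def nth_list_update)

lemma inj_flip: "inj_on (flip x) {..<length x}"
  by (rule inj_onI) (metis diff_flip_self(1) lessThan_iff singleton_inject)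

lemma open_nbhd_hypercube:
  assumes x: "x \<in> hypercube_verts d"
  shows "open_nbhd (hypercube_verts d) (hypercube_adj d) x = flip x ` {..<d}"
proof (intro set_eqI iffI)
  fix y assume y: "y \<in> open_nbhd (hypercube_verts d) (hypercube_adj d) x"
  then have len: "length x = d" "length y = d" and "card (diff x y) = 1"
    using x by (auto simp: open_nbhd_def hypercube_verts_def hypercube_adj_def diff_def)
  then obtain i where i: "diff x y = {i}" by (auto simp: card_1_singleton_iff)
  then have "i < d" using diff_subset[of x y] len by auto
  moreover from this have "y = flip x i"
    using len i diff_eq_iff[of x d y "flip x i"] diff_flip_self(1)[of i x] by (simp add: flip_def)
  ultimately show "y \<in> flip x ` {..<d}" by simp
next
  fix y assume "y \<in> flip x ` {..<d}"
  then obtain i where i: "i < d" "y = flip x i" by auto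
  have len: "length x = d" using x by (simp add: hypercube_verts_def)
  have "card (diff x y) = 1" using i len by (simp add: diff_flip_self)
  then show "y \<in> open_nbhd (hypercube_verts d) (hypercube_adj d) x"
    using i len by (simp add: open_nbhd_def hypercube_verts_def hypercube_adj_def diff_def flip_def)
qed

lemma sum_open_nbhd_hypercube:
  assumes x: "x \<in> hypercube_verts d"
  shows "(\<Sum>y\<in>open_nbhd (hypercube_verts d) (hypercube_adj d) x. g y) = (\<Sum>i<d. g (flip x i))"
  unfolding open_nbhd_hypercube[OF x]
  using inj_flip[of x] x by (simp add: sum.reindex hypercube_verts_def)

lemma card_closed_nbhd_hypercube:
  assumes x: "x \<in> hypercube_verts d"
  shows "card (closed_nbhd (hypercube_verts d) (hypercube_adj d) x) = d + 1"
proof -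
  have len: "length x = d" using x by (simp add: hypercube_verts_def)
  have "x \<notin> flip x ` {..<d}"
    using diff_flip_self(1)[of _ x] diff_self[of x] len by force
  then show ?thesis
    using inj_flip[of x] len by (simp add: closed_nbhd_def open_nbhd_hypercube[OF x] card_image)
qed

lemma finite_hypercube_verts: "finite (hypercube_verts d)"
  using finite_simple_graph_hypercube[of d] by (simp add: finite_simple_graph_def)

lemma card_hypercube_verts: "card (hypercube_verts d) = 2 ^ d"
  using card_lists_length_eq[of "UNIV :: bool set" d] by (simp add: hypercube_verts_def)

section \<open>The strategy of the defender\<close>

definition guard :: "nat \<Rightarrow> bool list \<Rightarrow> bool list \<Rightarrow> real" where
  "guard d v x = (if x = v then 1 else 1 / (real d + 1))"

text \<open>For neighbours \<open>x\<close> and \<open>y\<close> the sum has one term, whose index is the coordinate in which they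
  differ.\<close>

definition carry :: "nat \<Rightarrow> bool list \<Rightarrow> bool list \<Rightarrow> bool list \<Rightarrow> bool list \<Rightarrow> real" where
  "carry d u v x y =
     (if u = v then 0 else (\<Sum>i\<in>diff x y. cube_flow (diff u v) (diff u x) i) / (real d + 1))"

lemma fractional_dominating_guard:
  "fractional_dominating (hypercube_verts d) (hypercube_adj d) (guard d v)"
proof -
  have ge: "1 / (real d + 1) \<le> guard d v x" for x
    by (simp add: guard_def)
  have "1 \<le> (\<Sum>y\<in>closed_nbhd (hypercube_verts d) (hypercube_adj d) x. guard d v y)"
    if "x \<in> hypercube_verts d" for x
    using sum_bounded_below[of "closed_nbhd (hypercube_verts d) (hypercube_adj d) x"
        "1 / (real d + 1)" "guard d v"] ge
    by (simp add: card_closed_nbhd_hypercube[OF that] add.commute)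
  moreover have "0 \<le> guard d v x" for x by (simp add: guard_def)
  ultimately show ?thesis by (simp add: fractional_dominating_def)
qed

lemma sum_guard:
  assumes v: "v \<in> hypercube_verts d"
  shows "(\<Sum>x\<in>hypercube_verts d. guard d v x) = (2 ^ d + real d) / (real d + 1)"
proof -
  have "(\<Sum>x\<in>hypercube_verts d. guard d v x)
      = guard d v v + (\<Sum>x\<in>hypercube_verts d - {v}. guard d v x)"
    using v finite_hypercube_verts by (simp add: sum.remove)
  also have "(\<Sum>x\<in>hypercube_verts d - {v}. guard d v x)
      = (\<Sum>x\<in>hypercube_verts d - {v}. 1 / (real d + 1))"
    by (intro sum.cong) (auto simp: guard_def)
  also have "\<dots> = (2 ^ d - 1) / (real d + 1)"
    using v finite_hypercube_verts by (simp add: card_Diff_singleton card_hypercube_verts of_nat_diff)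
  finally show ?thesis by (simp add: guard_def field_simps)
qed

context
  fixes d :: nat and u v x :: "bool list"
  assumes u: "u \<in> hypercube_verts d" and v: "v \<in> hypercube_verts d"
    and x: "x \<in> hypercube_verts d" and uv: "u \<noteq> v"
begin

private lemma len: "length u = d" "length v = d" "length x = d"
  using u v x by (auto simp: hypercube_verts_def)

private lemma coords: "diff u v \<subseteq> {..<d}" "diff u v \<noteq> {}" "diff u x \<subseteq> {..<d}"
  using diff_subset[of u v] diff_subset[of u x] len uv diff_eq_iff[of u d v u] by (auto simp: diff_self)

private lemma coords_eq: "diff u x = {} \<longleftrightarrow> x = u" "diff u x = diff u v \<longleftrightarrow> x = v"
  using len diff_eq_iff[of u d x u] diff_eq_iff[of u d x v] by (auto simp: diff_self)

private lemma carry_out: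
  "(\<Sum>y\<in>open_nbhd (hypercube_verts d) (hypercube_adj d) x. carry d u v x y) =
     (\<Sum>i<d. cube_flow (diff u v) (diff u x) i) / (real d + 1)"
  unfolding sum_open_nbhd_hypercube[OF x] sum_divide_distrib
  using uv len by (intro sum.cong) (auto simp: carry_def diff_flip_self)

private lemma carry_in:
  "(\<Sum>y\<in>open_nbhd (hypercube_verts d) (hypercube_adj d) x. carry d u v y x) =
     (\<Sum>i<d. cube_flow (diff u v) (toggle i (diff u x)) i) / (real d + 1)"
  unfolding sum_open_nbhd_hypercube[OF x] sum_divide_distrib
  using uv len by (intro sum.cong) (auto simp: carry_def diff_flip_self diff_flip)

lemma carry_out_le:
  "(\<Sum>y\<in>open_nbhd (hypercube_verts d) (hypercube_adj d) x. carry d u v x y) \<le> guard d u x"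
proof (cases "x = u")
  case True
  then show ?thesis
    unfolding carry_out guard_def using cube_flow_out_source[OF coords] coords_eq by simp
next
  case False
  then show ?thesis
    unfolding carry_out guard_def using cube_flow_out_le_1[OF coords] coords_eq
    by (simp add: divide_right_mono)
qed

lemma apply_carry:
  "apply_move (hypercube_verts d) (hypercube_adj d) (guard d u) (carry d u v) x = guard d v x"
proof -
  have "apply_move (hypercube_verts d) (hypercube_adj d) (guard d u) (carry d u v) x =
      guard d u x - ((\<Sum>i<d. cube_flow (diff u v) (diff u x) i)
        - (\<Sum>i<d. cube_flow (diff u v) (toggle i (diff u x)) i)) / (real d + 1)"
    unfolding apply_move_def carry_out carry_in by (simp add: diff_divide_distrib)
  also have "\<dots> =
      guard d u x - ((if x = u then real d else 0) - (if x = v then real d else 0)) / (real d + 1)"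
    by (simp only: cube_flow_balance[OF coords] coords_eq)
  also have "\<dots> = guard d v x"
    using uv by (auto simp: guard_def field_simps)
  finally show ?thesis .
qed

end

lemma eternally_fractionally_dominated_hypercube:
  "eternally_fractionally_dominated (hypercube_verts d) (hypercube_adj d)
     ((2 ^ d + real d) / (real d + 1))"
proof (rule eternally_fractionally_dominated_family
    [where W = "guard d" and m = "carry d" and ?v0.0 = "replicate d False"])
  show "replicate d False \<in> hypercube_verts d" by (simp add: hypercube_verts_def)
  then show "(\<Sum>x\<in>hypercube_verts d. guard d (replicate d False) x)
      \<le> (2 ^ d + real d) / (real d + 1)"
    by (simp add: sum_guard)
  show "guard d v v \<ge> 1" for v by (simp add: guard_def)
next
  fix u v assume uv: "u \<in> hypercube_verts d" "v \<in> hypercube_verts d"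
  have "carry d u v x y \<ge> 0" for x y
    by (simp add: carry_def sum_nonneg cube_flow_nonneg)
  moreover have "(\<Sum>y\<in>open_nbhd (hypercube_verts d) (hypercube_adj d) x. carry d u v x y)
      \<le> guard d u x" if "x \<in> hypercube_verts d" for x
  proof (cases "u = v")
    case True
    then show ?thesis by (simp add: carry_def guard_def)
  qed (use carry_out_le[OF uv that] in simp)
  ultimately show "legal_move (hypercube_verts d) (hypercube_adj d) (guard d u) (carry d u v)"
    by (simp add: legal_move_def)
  fix x assume "x \<in> hypercube_verts d"
  then show "apply_move (hypercube_verts d) (hypercube_adj d) (guard d u) (carry d u v) x = guard d v x"
    using apply_carry[OF uv] by (cases "u = v") (simp_all add: apply_move_def carry_def)
qed (rule fractional_dominating_guard)

theorem theorem6p1: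
  fixes d :: nat
  assumes "d > 0"
  shows "2 ^ d / (real d + 1)
           \<le> fractional_eternal_domination_number (hypercube_verts d) (hypercube_adj d)
       \<and> fractional_eternal_domination_number (hypercube_verts d) (hypercube_adj d)
           \<le> (2 ^ d + real d) / (real d + 1)"
proof
  let ?E = "{S. eternally_fractionally_dominated (hypercube_verts d) (hypercube_adj d) S}"
  show "2 ^ d / (real d + 1)
      \<le> fractional_eternal_domination_number (hypercube_verts d) (hypercube_adj d)"
    unfolding fractional_eternal_domination_number_def
  proof (rule cInf_greatest)
    show "?E \<noteq> {}" using eternally_fractionally_dominated_hypercube by blast
    fix S assume "S \<in> ?E"
    then have "2 ^ d \<le> (real d + 1) * S"
      using card_le_eternally_fractionally_dominated[OF finite_simple_graph_hypercube
          card_closed_nbhd_hypercube, of d S]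
      by (simp add: card_hypercube_verts add.commute)
    then show "2 ^ d / (real d + 1) \<le> S" by (simp add: divide_le_eq mult.commute)
  qed
  show "fractional_eternal_domination_number (hypercube_verts d) (hypercube_adj d)
      \<le> (2 ^ d + real d) / (real d + 1)"
    unfolding fractional_eternal_domination_number_def
    using eternally_fractionally_dominated_hypercube
    by (intro cInf_lower bdd_below_eternally_fractionally_dominated) simp
qed

end
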